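(* Let $F$ be a non-abelian free group and let $\phi, \psi \colon F \to \mathbb{R}$ be two quasimorphisms such that each of $\phi$ and $\psi$ is either a Brooks counting quasimorphism on a non self-overlapping word or a Rolli quasimorphism. Then $[\delta^1 \phi] \smile [\delta^1 \psi] \in \mathrm{H}^4_b(F,\mathbb{R})$ is trivial.
   Context: Let $F$ be a non-abelian free group on a fixed free generating set $\mathcal{S}$. Bounded cohomology. $C^k(F,\mathbb{R})$ is the set of all functions $F^k\to\mathbb{R}$ and $C^k_b(F,\mathbb{R})$ the subset of bounded functions. The coboundary is $\delta^n(\alpha)(g_1,\ldots,g_{n+1}) = \alpha(g_2,\ldots,g_{n+1}) + \sum_{j=1}^n (-1)^j \alpha(g_1,\ldots,g_jg_{j+1},\ldots,g_{n+1}) + (-1)^{n+1}\alpha(g_1,\ldots,g_n)$. $\mathrm{H}^*_b(F,\mathbb{R})$ is the homology of $(C^*_b(F,\mathbb{R}),\delta^* )$. The cup product $\mathrm{H}^n_b\times \mathrm{H}^m_b\to \mathrm{H}^{n+m}_b$ is induced by $(\omega_1\smile\omega_2)(g_1,\ldots,g_{n+m})=\omega_1(g_1,\ldots,g_n)\,\omega_2(g_{n+1},\ldots,g_{n+m})$. A quasimorphism is a map $\alpha\colon F\to\mathbb{R}$ for which there is $D>0$ with $|\alpha(g)-\alpha(gh)+\alpha(h)|<D$ for all $g,h\in F$; thus $\delta^1\alpha\in C^2_b(F,\mathbb{R})$ is a bounded cocycle. Brooks quasimorphisms. A reduced word $w$ is non self-overlapping if there are no words $x,y$ with $x$ non-trivial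 such that $w=xyx$ as a reduced word. For such $w$, let $\nu_w(g)$ be the number of occurrences of $w$ as a (contiguous) subword of the reduced word representing $g$. The Brooks counting quasimorphism on $w$ is $\phi_w=\nu_w-\nu_{w^{-1}}$. Rolli quasimorphisms. Suppose $\mathcal{S}=\{x_1,\ldots,x_n\}$, and let $\lambda_1,\ldots,\lambda_n\colon\mathbb{Z}\to\mathbb{R}$ be bounded functions with $\lambda_j(-m)=-\lambda_j(m)$ for all $m$. Each non-trivial $g\in F$ can be uniquely written as $g=x_{n_1}^{m_1}\cdots x_{n_k}^{m_k}$ with all $m_j\neq 0$ and no two consecutive $n_j$ equal. The associated Rolli quasimorphism is $g\mapsto\sum_{j=1}^k\lambda_{n_j}(m_j)$ (with value $0$ at the identity). *)

theory Defs
  imports Complex_Main "HOL-Algebra.Coset"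
begin

section \<open>Free groups and reduced words\<close>

text \<open>The letter \<open>(x, True)\<close> stands for the generator \<open>x\<close>, and \<open>(x, False)\<close> for its inverse.\<close>

type_synonym 'g word = "('g \<times> bool) list"

definition reduced_words :: "'g set \<Rightarrow> 'g word set" where
  "reduced_words S =
     {w. set w \<subseteq> S \<times> UNIV \<and> successively (\<lambda>(x, b) (y, c). \<not> (x = y \<and> b \<noteq> c)) w}"

definition inv_word :: "'g word \<Rightarrow> 'g word" where
  "inv_word w = rev (map (\<lambda>(x, b). (x, \<not> b)) w)"

definition eval_word :: "('g, 'm) monoid_scheme \<Rightarrow> 'g word \<Rightarrow> 'g" where
  "eval_word G w =
     foldr (\<lambda>(x, b) g. (if b then x else inv\<^bsub>G\<^esub> x) \<otimes>\<^bsub>G\<^esub> g) w \<one>\<^bsub>G\<^esub>"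

text \<open>
  \<open>S\<close> is a free generating set of \<open>G\<close>: every element of \<open>G\<close> is represented by exactly one
  reduced word over \<open>S\<close>.  (The universal property would quantify over groups of all types.)
\<close>

locale free_group = group G for G :: "('g, 'm) monoid_scheme" (structure) +
  fixes S :: "'g set"
  assumes generators_closed: "S \<subseteq> carrier G"
    and unique_reduced_word: "bij_betw (eval_word G) (reduced_words S) (carrier G)"

definition reduced_word :: "('g, 'm) monoid_scheme \<Rightarrow> 'g set \<Rightarrow> 'g \<Rightarrow> 'g word" where
  "reduced_word G S g = (THE w. w \<in> reduced_words S \<and> eval_word G w = g)"


section \<open>Quasimorphisms\<close>

definition quasimorphism :: "('g, 'm) monoid_scheme \<Rightarrow> ('g \<Rightarrow> real) \<Rightarrow> bool" where
  "quasimorphism G \<alpha> \<longleftrightarrow>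
     (\<exists>D>0. \<forall>g\<in>carrier G. \<forall>h\<in>carrier G. \<bar>\<alpha> g - \<alpha> (g \<otimes>\<^bsub>G\<^esub> h) + \<alpha> h\<bar> < D)"

subsection \<open>Brooks counting quasimorphisms\<close>

definition non_self_overlapping :: "'g word \<Rightarrow> bool" where
  "non_self_overlapping w \<longleftrightarrow> \<not> (\<exists>x y. x \<noteq> [] \<and> w = x @ y @ x)"

text \<open>An occurrence of \<open>w\<close> in \<open>v\<close> is a factorisation of \<open>v\<close> as \<open>p w s\<close>; overlaps are allowed.\<close>

definition occurrences :: "'g word \<Rightarrow> 'g word \<Rightarrow> nat" where
  "occurrences w v = card {(p, s). v = p @ w @ s}"

definition brooks :: "('g, 'm) monoid_scheme \<Rightarrow> 'g set \<Rightarrow> 'g word \<Rightarrow> 'g \<Rightarrow> real" where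
  "brooks G S w g =
     real (occurrences w (reduced_word G S g)) - real (occurrences (inv_word w) (reduced_word G S g))"

definition is_brooks :: "('g, 'm) monoid_scheme \<Rightarrow> 'g set \<Rightarrow> ('g \<Rightarrow> real) \<Rightarrow> bool" where
  "is_brooks G S \<phi> \<longleftrightarrow>
     (\<exists>w\<in>reduced_words S. non_self_overlapping w \<and> (\<forall>g\<in>carrier G. \<phi> g = brooks G S w g))"

subsection \<open>Rolli quasimorphisms\<close>

text \<open>The list \<open>[(x\<^sub>1, m\<^sub>1), \<dots>, (x\<^sub>k, m\<^sub>k)]\<close> stands for the product of the powers of \<open>x\<^sub>j\<close> by \<open>m\<^sub>j\<close>.\<close>

definition syllable_forms :: "'g set \<Rightarrow> ('g \<times> int) list set" where
  "syllable_forms S =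
     {ys. set ys \<subseteq> S \<times> (UNIV - {0}) \<and> successively (\<lambda>(x, _) (y, _). x \<noteq> y) ys}"

definition eval_syllables :: "('g, 'm) monoid_scheme \<Rightarrow> ('g \<times> int) list \<Rightarrow> 'g" where
  "eval_syllables G ys = foldr (\<lambda>(x, m) g. (x [^]\<^bsub>G\<^esub> m) \<otimes>\<^bsub>G\<^esub> g) ys \<one>\<^bsub>G\<^esub>"

definition syllables :: "('g, 'm) monoid_scheme \<Rightarrow> 'g set \<Rightarrow> 'g \<Rightarrow> ('g \<times> int) list" where
  "syllables G S g = (THE ys. ys \<in> syllable_forms S \<and> eval_syllables G ys = g)"

definition rolli ::
  "('g, 'm) monoid_scheme \<Rightarrow> 'g set \<Rightarrow> ('g \<Rightarrow> int \<Rightarrow> real) \<Rightarrow> 'g \<Rightarrow> real" where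
  "rolli G S lam g = (\<Sum>(x, m)\<leftarrow>syllables G S g. lam x m)"

definition is_rolli :: "('g, 'm) monoid_scheme \<Rightarrow> 'g set \<Rightarrow> ('g \<Rightarrow> real) \<Rightarrow> bool" where
  "is_rolli G S \<phi> \<longleftrightarrow> finite S \<and>
     (\<exists>lam. (\<forall>x\<in>S. (\<exists>B. \<forall>m. \<bar>lam x m\<bar> \<le> B) \<and> (\<forall>m. lam x (- m) = - lam x m)) \<and>
            (\<forall>g\<in>carrier G. \<phi> g = rolli G S lam g))"


section \<open>Bounded cohomology with real coefficients\<close>

text \<open>
  \<open>G\<^sup>k\<close> is the set of lists of length \<open>k\<close> over the carrier, and cochains are extensional functions
  on it, so that cochains are equal iff they agree on \<open>G\<^sup>k\<close>.
\<close>

definition tuples :: "('g, 'm) monoid_scheme \<Rightarrow> nat \<Rightarrow> 'g list set" where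
  "tuples G k = {gs. length gs = k \<and> set gs \<subseteq> carrier G}"

definition cochains :: "('g, 'm) monoid_scheme \<Rightarrow> nat \<Rightarrow> ('g list \<Rightarrow> real) set" where
  "cochains G k = tuples G k \<rightarrow>\<^sub>E UNIV"

definition bcochains :: "('g, 'm) monoid_scheme \<Rightarrow> nat \<Rightarrow> ('g list \<Rightarrow> real) set" where
  "bcochains G k = {\<alpha> \<in> cochains G k. \<exists>B. \<forall>gs\<in>tuples G k. \<bar>\<alpha> gs\<bar> \<le> B}"

definition zero_cochain :: "('g, 'm) monoid_scheme \<Rightarrow> nat \<Rightarrow> 'g list \<Rightarrow> real" where
  "zero_cochain G k = (\<lambda>gs\<in>tuples G k. 0)"

text \<open>List indices start at 0, so \<open>g\<^sub>j\<close> is \<open>gs ! (j - 1)\<close>.\<close>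

definition coboundary ::
  "('g, 'm) monoid_scheme \<Rightarrow> nat \<Rightarrow> ('g list \<Rightarrow> real) \<Rightarrow> 'g list \<Rightarrow> real" where
  "coboundary G n \<alpha> = (\<lambda>gs\<in>tuples G (n + 1).
     \<alpha> (tl gs)
     + (\<Sum>j=1..n. (-1) ^ j * \<alpha> (take (j - 1) gs @ [gs ! (j - 1) \<otimes>\<^bsub>G\<^esub> gs ! j] @ drop (j + 1) gs))
     + (-1) ^ (n + 1) * \<alpha> (butlast gs))"

definition bcocycles :: "('g, 'm) monoid_scheme \<Rightarrow> nat \<Rightarrow> ('g list \<Rightarrow> real) set" where
  "bcocycles G n = {\<alpha> \<in> bcochains G n. coboundary G n \<alpha> = zero_cochain G (n + 1)}"

fun bcoboundaries :: "('g, 'm) monoid_scheme \<Rightarrow> nat \<Rightarrow> ('g list \<Rightarrow> real) set" where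
  "bcoboundaries G 0 = {zero_cochain G 0}"
| "bcoboundaries G (Suc n) = coboundary G n ` bcochains G n"

definition bcocycle_group ::
  "('g, 'm) monoid_scheme \<Rightarrow> nat \<Rightarrow> ('g list \<Rightarrow> real) monoid" where
  "bcocycle_group G n =
     \<lparr>carrier = bcocycles G n,
      mult = (\<lambda>\<alpha> \<beta>. \<lambda>gs\<in>tuples G n. \<alpha> gs + \<beta> gs),
      one = zero_cochain G n\<rparr>"

text \<open>
  \<open>H\<^sub>b\<^sup>n(G, \<real>)\<close> as an abelian group, written multiplicatively: its zero is \<open>\<one>\<^bsub>bounded_cohomology G n\<^esub>\<close>.
\<close>

definition bounded_cohomology ::
  "('g, 'm) monoid_scheme \<Rightarrow> nat \<Rightarrow> ('g list \<Rightarrow> real) set monoid" where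
  "bounded_cohomology G n = bcocycle_group G n Mod bcoboundaries G n"

definition bclass ::
  "('g, 'm) monoid_scheme \<Rightarrow> nat \<Rightarrow> ('g list \<Rightarrow> real) \<Rightarrow> ('g list \<Rightarrow> real) set" where
  "bclass G n \<alpha> = bcoboundaries G n #>\<^bsub>bcocycle_group G n\<^esub> \<alpha>"

definition cup_cochain ::
  "('g, 'm) monoid_scheme \<Rightarrow> nat \<Rightarrow> nat \<Rightarrow> ('g list \<Rightarrow> real) \<Rightarrow> ('g list \<Rightarrow> real) \<Rightarrow> 'g list \<Rightarrow> real" where
  "cup_cochain G n m \<omega>\<^sub>1 \<omega>\<^sub>2 = (\<lambda>gs\<in>tuples G (n + m). \<omega>\<^sub>1 (take n gs) * \<omega>\<^sub>2 (drop n gs))"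

text \<open>
  The product induced on cohomology classes.  All pairs of representatives yield the same class,
  so the union is that class.
\<close>

definition cup ::
  "('g, 'm) monoid_scheme \<Rightarrow> nat \<Rightarrow> nat \<Rightarrow>
     ('g list \<Rightarrow> real) set \<Rightarrow> ('g list \<Rightarrow> real) set \<Rightarrow> ('g list \<Rightarrow> real) set" where
  "cup G n m A B = (\<Union>\<omega>\<^sub>1\<in>A. \<Union>\<omega>\<^sub>2\<in>B. bclass G (n + m) (cup_cochain G n m \<omega>\<^sub>1 \<omega>\<^sub>2))"

definition one_cochain :: "('g, 'm) monoid_scheme \<Rightarrow> ('g \<Rightarrow> real) \<Rightarrow> 'g list \<Rightarrow> real" where
  "one_cochain G \<phi> = (\<lambda>gs\<in>tuples G 1. \<phi> (hd gs))"

end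

theory Submission
  imports Defs
begin

text \<open>
  Suppose \<open>\<phi>\<close> lifts to finitely supported measures \<open>\<mu>\<^sub>g\<close> on \<open>G\<close> of total mass \<open>\<phi>(g)\<close> such that
  \<open>\<mu>\<^sub>h - \<mu>\<^sub>g\<^sub>h + \<mu>\<^sub>g \<cdot> h\<close> is bounded in \<open>\<ell>\<^sup>1\<close>.  Then for every bounded 2-cocycle \<open>\<omega>\<close> the pairing
  \<open>\<gamma>(g, h, k) = \<langle>\<mu>\<^sub>h - \<mu>\<^sub>g\<^sub>h + \<mu>\<^sub>g \<cdot> h, \<omega>(\<cdot>, k)\<rangle>\<close> is a bounded 3-cochain whose coboundary is
  \<open>\<delta>\<phi> \<smile> \<omega>\<close>.  A quasimorphism that sums an antisymmetric weight over the subwords \<open>v\<close> of a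
  normal form \<open>p v s\<close> lifts: put half of the weight of \<open>v\<close> at \<open>s\<close> and half at \<open>v s\<close>.  The
  contributions of a cancelling part of a product \<open>g h\<close> then cancel exactly, because inversion
  exchanges the two endpoints of each subword.  Brooks quasimorphisms weigh subwords of the reduced
  word, Rolli quasimorphisms weigh single syllables.\<close>

section \<open>Lifts to quasicocycles\<close>

text \<open>The functional \<open>E g\<close> is integration against the measure \<open>\<mu>\<^sub>g\<close>.\<close>

definition quasicocycle_lift ::
  "('g, 'm) monoid_scheme \<Rightarrow> ('g \<Rightarrow> real) \<Rightarrow> ('g \<Rightarrow> ('g \<Rightarrow> real) \<Rightarrow> real) \<Rightarrow> bool" where
  "quasicocycle_lift G \<phi> E \<longleftrightarrow>
     (\<forall>g\<in>carrier G. \<forall>f f'. E g (\<lambda>x. f x + f' x) = E g f + E g f') \<and>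
     (\<forall>g\<in>carrier G. \<forall>c f. E g (\<lambda>x. c * f x) = c * E g f) \<and>
     (\<forall>g\<in>carrier G. \<forall>f f'. (\<forall>x\<in>carrier G. f x = f' x) \<longrightarrow> E g f = E g f') \<and>
     (\<forall>g\<in>carrier G. E g (\<lambda>_. 1) = \<phi> g) \<and>
     (\<exists>K. \<forall>B f. (\<forall>x\<in>carrier G. \<bar>f x\<bar> \<le> B) \<longrightarrow>
        (\<forall>g\<in>carrier G. \<forall>h\<in>carrier G.
           \<bar>E h f + E g (\<lambda>x. f (x \<otimes>\<^bsub>G\<^esub> h)) - E (g \<otimes>\<^bsub>G\<^esub> h) f\<bar> \<le> K * B))"

text \<open>An arbitrary representative of the class of \<delta>\<phi> is \<delta>(\<phi> + b) with
  b bounded, so lifts must survive this change. A point mass \<open>b g\<close> at the identity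
  carries the extra mass; each of the three new terms in the defect is at most
  \<open>C * B\<close>.\<close>

lemma quasicocycle_lift_add_bounded:
  assumes G: "group G" and E: "quasicocycle_lift G \<phi> E"
    and b: "\<And>g. g \<in> carrier G \<Longrightarrow> \<bar>b g\<bar> \<le> C"
  shows "quasicocycle_lift G (\<lambda>g. \<phi> g + b g) (\<lambda>g f. E g f + b g * f \<one>\<^bsub>G\<^esub>)"
proof -
  interpret group G by fact
  obtain K where K: "\<And>B f g h. (\<forall>x\<in>carrier G. \<bar>f x\<bar> \<le> B) \<Longrightarrow> g \<in> carrier G \<Longrightarrow> h \<in> carrier G \<Longrightarrow>
      \<bar>E h f + E g (\<lambda>x. f (x \<otimes>\<^bsub>G\<^esub> h)) - E (g \<otimes>\<^bsub>G\<^esub> h) f\<bar> \<le> K * B"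
    using E unfolding quasicocycle_lift_def by blast
  have prod: "\<bar>b x * f y\<bar> \<le> C * B" if "x \<in> carrier G" "y \<in> carrier G" "\<forall>x\<in>carrier G. \<bar>f x\<bar> \<le> B"
    for f B x y
    unfolding abs_mult using that b[OF that(1)] by (intro mult_mono) auto
  have "\<bar>(E h f + b h * f \<one>\<^bsub>G\<^esub>) + (E g (\<lambda>x. f (x \<otimes>\<^bsub>G\<^esub> h)) + b g * f (\<one>\<^bsub>G\<^esub> \<otimes>\<^bsub>G\<^esub> h))
      - (E (g \<otimes>\<^bsub>G\<^esub> h) f + b (g \<otimes>\<^bsub>G\<^esub> h) * f \<one>\<^bsub>G\<^esub>)\<bar> \<le> (K + 3 * C) * B"
    if f: "\<forall>x\<in>carrier G. \<bar>f x\<bar> \<le> B" and g: "g \<in> carrier G" and h: "h \<in> carrier G" for B f g h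
    using K[OF f g h] prod[OF h one_closed f] prod[OF g m_closed[OF one_closed h] f]
      prod[OF m_closed[OF g h] one_closed f]
    by (simp add: algebra_simps)
  then have "\<exists>K. \<forall>B f. (\<forall>x\<in>carrier G. \<bar>f x\<bar> \<le> B) \<longrightarrow>
        (\<forall>g\<in>carrier G. \<forall>h\<in>carrier G.
          \<bar>(E h f + b h * f \<one>\<^bsub>G\<^esub>) + (E g (\<lambda>x. f (x \<otimes>\<^bsub>G\<^esub> h)) + b g * f (\<one>\<^bsub>G\<^esub> \<otimes>\<^bsub>G\<^esub> h))
           - (E (g \<otimes>\<^bsub>G\<^esub> h) f + b (g \<otimes>\<^bsub>G\<^esub> h) * f \<one>\<^bsub>G\<^esub>)\<bar> \<le> K * B)"
    by blast
  moreover have "\<forall>g\<in>carrier G. \<forall>f f'. (\<forall>x\<in>carrier G. f x = f' x) \<longrightarrow>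
      E g f + b g * f \<one>\<^bsub>G\<^esub> = E g f' + b g * f' \<one>\<^bsub>G\<^esub>"
    using E unfolding quasicocycle_lift_def by (metis one_closed)
  ultimately show ?thesis
    using E unfolding quasicocycle_lift_def by (simp add: algebra_simps)
qed


section \<open>Low-dimensional cochains\<close>

lemma tuples_0: "gs \<in> tuples G 0 \<longleftrightarrow> gs = []"
  by (auto simp: tuples_def)

lemma tuples_Suc:
  "gs \<in> tuples G (Suc n) \<longleftrightarrow> (\<exists>g\<in>carrier G. \<exists>hs\<in>tuples G n. gs = g # hs)"
  by (cases gs) (auto simp: tuples_def)

lemmas tuples_numeral = numeral_eq_Suc pred_numeral_simps BitM.simps One_nat_def tuples_Suc tuples_0

lemma coboundary_1:
  assumes "g \<in> carrier G" "h \<in> carrier G"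
  shows "coboundary G 1 \<alpha> [g, h] = \<alpha> [h] - \<alpha> [g \<otimes>\<^bsub>G\<^esub> h] + \<alpha> [g]"
  using assms by (simp add: coboundary_def tuples_def)

lemma coboundary_3:
  assumes "g \<in> carrier G" "h \<in> carrier G" "k \<in> carrier G" "l \<in> carrier G"
  shows "coboundary G 3 \<alpha> [g, h, k, l] =
    \<alpha> [h, k, l] - \<alpha> [g \<otimes>\<^bsub>G\<^esub> h, k, l] + \<alpha> [g, h \<otimes>\<^bsub>G\<^esub> k, l] - \<alpha> [g, h, k \<otimes>\<^bsub>G\<^esub> l] + \<alpha> [g, h, k]"
proof -
  have "{1..3} = {1, 2, 3::nat}" by auto
  then show ?thesis
    using assms by (simp add: coboundary_def tuples_def numeral_eq_Suc)
qed

text \<open>The scalar \<open>c\<close> lets one statement serve both sums (\<open>c = 1\<close>)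
  and differences (\<open>c = -1\<close>).\<close>

lemma coboundary_lincomb:
  assumes G: "group G"
  shows "coboundary G n (\<lambda>gs\<in>tuples G n. \<alpha> gs + c * \<beta> gs) =
    (\<lambda>gs\<in>tuples G (n + 1). coboundary G n \<alpha> gs + c * coboundary G n \<beta> gs)"
proof (rule ext)
  interpret group G by fact
  fix gs
  show "coboundary G n (\<lambda>gs\<in>tuples G n. \<alpha> gs + c * \<beta> gs) gs =
    (\<lambda>gs\<in>tuples G (n + 1). coboundary G n \<alpha> gs + c * coboundary G n \<beta> gs) gs"
  proof (cases "gs \<in> tuples G (n + 1)")
    case True
    then have gs: "length gs = Suc n" "set gs \<subseteq> carrier G"
      by (auto simp: tuples_def)
    have "tl gs \<in> tuples G n" "butlast gs \<in> tuples G n"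
      using gs by (auto simp: tuples_def dest: in_set_butlastD list.set_sel(2)[rotated])
    moreover have "take (j - 1) gs @ [gs ! (j - 1) \<otimes>\<^bsub>G\<^esub> gs ! j] @ drop (j + 1) gs \<in> tuples G n"
      if "j \<in> {1..n}" for j
      using that gs nth_mem[of _ gs]
      by (auto simp: tuples_def dest!: in_set_takeD in_set_dropD intro!: m_closed)
    ultimately show ?thesis
      using True by (simp add: coboundary_def sum_distrib_left sum.distrib algebra_simps)
  qed (simp add: coboundary_def)
qed

lemma bcochains_lincomb:
  assumes "\<alpha> \<in> bcochains G n" "\<beta> \<in> bcochains G n"
  shows "(\<lambda>gs\<in>tuples G n. \<alpha> gs + c * \<beta> gs) \<in> bcochains G n"
proof -
  obtain A B where "\<forall>gs\<in>tuples G n. \<bar>\<alpha> gs\<bar> \<le> A" and B: "\<forall>gs\<in>tuples G n. \<bar>\<beta> gs\<bar> \<le> B"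
    using assms by (auto simp: bcochains_def)
  moreover from B have "\<forall>gs\<in>tuples G n. \<bar>c * \<beta> gs\<bar> \<le> \<bar>c\<bar> * B"
    by (simp add: abs_mult mult_left_mono)
  ultimately have "\<forall>gs\<in>tuples G n. \<bar>\<alpha> gs + c * \<beta> gs\<bar> \<le> A + \<bar>c\<bar> * B"
    by (smt (verit))
  then show ?thesis
    by (auto simp: bcochains_def cochains_def)
qed

section \<open>Classes in bounded cohomology and their cup product\<close>

lemma mem_bclass_iff:
  "\<omega> \<in> bclass G n \<alpha> \<longleftrightarrow> (\<exists>\<eta>\<in>bcoboundaries G n. \<omega> = (\<lambda>gs\<in>tuples G n. \<eta> gs + \<alpha> gs))"
  by (auto simp: bclass_def r_coset_def bcocycle_group_def)

text \<open>A subgroup translated by one of its own elements is itself. The degree is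
  \<open>Suc n\<close> because only in positive degree is \<open>bcoboundaries\<close> an image of
  cochains.\<close>

lemma bclass_bcoboundary:
  assumes G: "group G" and \<alpha>: "\<alpha> \<in> bcoboundaries G (Suc n)"
  shows "bclass G (Suc n) \<alpha> = bcoboundaries G (Suc n)"
proof -
  obtain a where a: "a \<in> bcochains G n" "\<alpha> = coboundary G n a"
    using \<alpha> by auto
  have "(\<lambda>gs\<in>tuples G (Suc n). coboundary G n b gs + c * \<alpha> gs) \<in> bcoboundaries G (Suc n)"
    if "b \<in> bcochains G n" for b c
    using coboundary_lincomb[OF G, of n b c a] bcochains_lincomb[OF that a(1), of c] a(2)
    by (simp del: restrict_apply) (metis image_eqI)
  from this[of _ 1] this[of _ "-1"]
  have sum: "(\<lambda>gs\<in>tuples G (Suc n). \<eta> gs + \<alpha> gs) \<in> bcoboundaries G (Suc n)"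
    and diff: "(\<lambda>gs\<in>tuples G (Suc n). \<eta> gs - \<alpha> gs) \<in> bcoboundaries G (Suc n)"
    if "\<eta> \<in> bcoboundaries G (Suc n)" for \<eta>
    using that by auto
  \<comment> \<open>Every coboundary is hit by the translation. Off the tuples both sides are
    \<open>undefined\<close>, since coboundaries are extensional.\<close>
  have "\<eta> = (\<lambda>gs\<in>tuples G (Suc n). (\<lambda>gs\<in>tuples G (Suc n). \<eta> gs - \<alpha> gs) gs + \<alpha> gs)"
    if "\<eta> \<in> bcoboundaries G (Suc n)" for \<eta>
    using that by (auto simp: coboundary_def)
  then show ?thesis
    using sum diff unfolding set_eq_iff mem_bclass_iff by blast
qed

text \<open>In \<delta>\<gamma>(g, h, k, l) the integrals for k, hk and ghk cancel in pairs. What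
  remains integrates \<omega>(xk, l) - \<omega>(x, kl) + \<omega>(x, k), which is the constant
  \<omega>(k, l) by the cocycle identity, for h and gh, and with x replaced by xh for g. The total
  masses add up to \<theta>(g, h).\<close>

lemma cup_product_bcoboundary:
  assumes G: "group G" and E: "quasicocycle_lift G \<phi> E"
    and bd: "\<And>g h. g \<in> carrier G \<Longrightarrow> h \<in> carrier G \<Longrightarrow> \<bar>\<omega> [g, h]\<bar> \<le> B"
    and cocycle: "\<And>g h k. g \<in> carrier G \<Longrightarrow> h \<in> carrier G \<Longrightarrow> k \<in> carrier G \<Longrightarrow>
      \<omega> [g \<otimes>\<^bsub>G\<^esub> h, k] - \<omega> [g, h \<otimes>\<^bsub>G\<^esub> k] + \<omega> [g, h] = \<omega> [h, k]"
    and \<theta>: "\<And>g h. g \<in> carrier G \<Longrightarrow> h \<in> carrier G \<Longrightarrow> \<theta> [g, h] = \<phi> h - \<phi> (g \<otimes>\<^bsub>G\<^esub> h) + \<phi> g"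
  shows "cup_cochain G 2 2 \<theta> \<omega> \<in> bcoboundaries G 4"
proof -
  interpret group G by fact
  have add: "E g (\<lambda>x. f x + f' x) = E g f + E g f'"
    and scale: "E g (\<lambda>x. c * f x) = c * E g f"
    and cong: "(\<And>x. x \<in> carrier G \<Longrightarrow> f x = f' x) \<Longrightarrow> E g f = E g f'"
    and one: "E g (\<lambda>_. 1) = \<phi> g"
    if "g \<in> carrier G" for g f f' c
    using E that unfolding quasicocycle_lift_def by blast+
  obtain K where K: "\<And>B f g h. (\<forall>x\<in>carrier G. \<bar>f x\<bar> \<le> B) \<Longrightarrow> g \<in> carrier G \<Longrightarrow> h \<in> carrier G \<Longrightarrow>
      \<bar>E h f + E g (\<lambda>x. f (x \<otimes>\<^bsub>G\<^esub> h)) - E (g \<otimes>\<^bsub>G\<^esub> h) f\<bar> \<le> K * B"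
    using E unfolding quasicocycle_lift_def by blast
  have E_const: "E g f - E g f' + E g f'' = c * \<phi> g"
    if g: "g \<in> carrier G" and "\<And>x. x \<in> carrier G \<Longrightarrow> f x - f' x + f'' x = c" for g f f' f'' c
  proof -
    have "E g f - E g f' + E g f'' = E g (\<lambda>x. (f x + (-1) * f' x) + f'' x)"
      unfolding add[OF g] scale[OF g] by simp
    also have "\<dots> = E g (\<lambda>x. c * 1)"
      using that by (intro cong) auto
    finally show ?thesis
      unfolding scale[OF g] one[OF g] .
  qed
  \<comment> \<open>The defect of the lift at (g, h), paired with \<omega>(., k). The bound on the
    defect as a functional makes this cochain bounded.\<close>
  define \<gamma> where "\<gamma> = (\<lambda>gs\<in>tuples G 3. E (gs ! 1) (\<lambda>x. \<omega> [x, gs ! 2])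
    + E (gs ! 0) (\<lambda>x. \<omega> [x \<otimes>\<^bsub>G\<^esub> gs ! 1, gs ! 2]) - E (gs ! 0 \<otimes>\<^bsub>G\<^esub> gs ! 1) (\<lambda>x. \<omega> [x, gs ! 2]))"
  have \<gamma>: "\<gamma> [g, h, k] = E h (\<lambda>x. \<omega> [x, k]) + E g (\<lambda>x. \<omega> [x \<otimes>\<^bsub>G\<^esub> h, k]) - E (g \<otimes>\<^bsub>G\<^esub> h) (\<lambda>x. \<omega> [x, k])"
    if "g \<in> carrier G" "h \<in> carrier G" "k \<in> carrier G" for g h k
    using that by (simp add: \<gamma>_def tuples_def)
  have "\<bar>\<gamma> gs\<bar> \<le> K * B" if gs: "gs \<in> tuples G 3" for gs
  proof -
    obtain g h k where ghk: "gs = [g, h, k]" "g \<in> carrier G" "h \<in> carrier G" "k \<in> carrier G"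
      using gs by (auto simp: tuples_numeral)
    show ?thesis
      unfolding ghk(1) \<gamma>[OF ghk(2-)] using ghk bd by (intro K) auto
  qed
  then have "\<gamma> \<in> bcochains G 3"
    by (auto simp: bcochains_def cochains_def \<gamma>_def)
  moreover have "cup_cochain G 2 2 \<theta> \<omega> = coboundary G 3 \<gamma>"
  proof (rule ext)
    fix gs
    show "cup_cochain G 2 2 \<theta> \<omega> gs = coboundary G 3 \<gamma> gs"
    proof (cases "gs \<in> tuples G 4")
      case True
      then obtain g h k l where gs: "gs = [g, h, k, l]" and
        mem: "g \<in> carrier G" "h \<in> carrier G" "k \<in> carrier G" "l \<in> carrier G"
        by (auto simp: tuples_numeral)
      have "E g' (\<lambda>x. \<omega> [x \<otimes>\<^bsub>G\<^esub> k, l]) - E g' (\<lambda>x. \<omega> [x, k \<otimes>\<^bsub>G\<^esub> l]) + E g' (\<lambda>x. \<omega> [x, k])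
          = \<omega> [k, l] * \<phi> g'" if "g' \<in> carrier G" for g'
        using mem that cocycle by (intro E_const) auto
      \<comment> \<open>The cocycle identity at (x, k, l) is integrated for h and gh; next, the
        identity at (xh, k, l) is integrated for g.\<close>
      note this[OF mem(2)] this[OF m_closed[OF mem(1,2)]]
      moreover have "E g (\<lambda>x. \<omega> [x \<otimes>\<^bsub>G\<^esub> (h \<otimes>\<^bsub>G\<^esub> k), l]) - E g (\<lambda>x. \<omega> [x \<otimes>\<^bsub>G\<^esub> h, k \<otimes>\<^bsub>G\<^esub> l])
          + E g (\<lambda>x. \<omega> [x \<otimes>\<^bsub>G\<^esub> h, k]) = \<omega> [k, l] * \<phi> g"
        using mem cocycle by (intro E_const) (auto simp: m_assoc[symmetric])
      moreover have "cup_cochain G 2 2 \<theta> \<omega> gs = (\<phi> h - \<phi> (g \<otimes>\<^bsub>G\<^esub> h) + \<phi> g) * \<omega> [k, l]"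
        using True mem by (simp add: gs cup_cochain_def \<theta>)
      ultimately show ?thesis
        unfolding gs using mem by (simp add: coboundary_3 \<gamma> m_assoc algebra_simps)
    qed (simp add: cup_cochain_def coboundary_def)
  qed
  ultimately show ?thesis
    by (simp add: eval_nat_numeral)
qed

text \<open>As \<open>cup\<close> is a union over pairs of representatives, every pair must give the
  zero class and both classes must be nonempty. \<phi> supplies the lift and \<psi> the bounded
  cocycles.\<close>

lemma cup_eq_one:
  assumes G: "group G" and E: "quasicocycle_lift G \<phi> E" and qm: "quasimorphism G \<psi>"
  shows "cup G 2 2
           (bclass G 2 (coboundary G 1 (one_cochain G \<phi>)))
           (bclass G 2 (coboundary G 1 (one_cochain G \<psi>)))
         = \<one>\<^bsub>bounded_cohomology G 4\<^esub>"
proof -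
  interpret group G by fact
  let ?A = "\<lambda>\<phi>. bclass G 2 (coboundary G 1 (one_cochain G \<phi>))"
  \<comment> \<open>A representative differs from the coboundary of \<phi> by that of a bounded
    \<open>b\<close>, which is absorbed into \<phi>.\<close>
  have mem: "\<exists>b C. (\<forall>g\<in>carrier G. \<bar>b g\<bar> \<le> C) \<and>
      (\<forall>g\<in>carrier G. \<forall>h\<in>carrier G. \<theta> [g, h] =
         (\<phi> h + b h) - (\<phi> (g \<otimes>\<^bsub>G\<^esub> h) + b (g \<otimes>\<^bsub>G\<^esub> h)) + (\<phi> g + b g))"
    if \<theta>: "\<theta> \<in> ?A \<phi>" for \<theta> \<phi>
  proof -
    obtain \<eta> where \<eta>: "\<eta> \<in> bcoboundaries G (Suc 1)"
      and \<theta>': "\<theta> = (\<lambda>gs\<in>tuples G 2. \<eta> gs + coboundary G 1 (one_cochain G \<phi>) gs)"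
      using \<theta> by (auto simp: mem_bclass_iff numeral_2_eq_2)
    obtain b where b: "b \<in> bcochains G 1" "\<eta> = coboundary G 1 b"
      using \<eta> unfolding bcoboundaries.simps by blast
    obtain C where "\<forall>gs\<in>tuples G 1. \<bar>b gs\<bar> \<le> C"
      using b by (auto simp: bcochains_def)
    then have "\<forall>g\<in>carrier G. \<bar>b [g]\<bar> \<le> C"
      by (auto simp: tuples_def)
    moreover have "\<theta> [g, h] = (\<phi> h + b [h]) - (\<phi> (g \<otimes>\<^bsub>G\<^esub> h) + b [g \<otimes>\<^bsub>G\<^esub> h]) + (\<phi> g + b [g])"
      if "g \<in> carrier G" "h \<in> carrier G" for g h
      using that unfolding \<theta>' b(2)
      by (simp add: coboundary_1[simplified] one_cochain_def tuples_def)
    ultimately show ?thesis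
      by (intro exI[of _ "\<lambda>g. b [g]"]) auto
  qed
  obtain D where D: "\<And>g h. g \<in> carrier G \<Longrightarrow> h \<in> carrier G \<Longrightarrow> \<bar>\<psi> g - \<psi> (g \<otimes>\<^bsub>G\<^esub> h) + \<psi> h\<bar> < D"
    using qm by (auto simp: quasimorphism_def)
  have triv: "bclass G 4 (cup_cochain G 2 2 \<theta> \<omega>) = bcoboundaries G 4"
    if \<theta>: "\<theta> \<in> ?A \<phi>" and \<omega>: "\<omega> \<in> ?A \<psi>" for \<theta> \<omega>
  proof -
    obtain b C where b: "\<forall>g\<in>carrier G. \<bar>b g\<bar> \<le> C"
      and \<theta>': "\<forall>g\<in>carrier G. \<forall>h\<in>carrier G. \<theta> [g, h] =
         (\<phi> h + b h) - (\<phi> (g \<otimes>\<^bsub>G\<^esub> h) + b (g \<otimes>\<^bsub>G\<^esub> h)) + (\<phi> g + b g)"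
      using mem[OF \<theta>] by blast
    obtain b' C' where b': "\<forall>g\<in>carrier G. \<bar>b' g\<bar> \<le> C'"
      and \<omega>': "\<forall>g\<in>carrier G. \<forall>h\<in>carrier G. \<omega> [g, h] =
         (\<psi> h + b' h) - (\<psi> (g \<otimes>\<^bsub>G\<^esub> h) + b' (g \<otimes>\<^bsub>G\<^esub> h)) + (\<psi> g + b' g)"
      using mem[OF \<omega>] by blast
    \<comment> \<open>\<open>D\<close> bounds the coboundary of \<psi>, and each of the three values
      of \<open>b'\<close> adds at most \<open>C'\<close>.\<close>
    have "\<bar>\<omega> [g, h]\<bar> \<le> D + 3 * C'" if "g \<in> carrier G" "h \<in> carrier G" for g h
      using D[OF that] b'[rule_format, OF that(1)] b'[rule_format, OF that(2)]
        b'[rule_format, OF m_closed[OF that]] \<omega>'[rule_format, OF that] by linarith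
    then have "cup_cochain G 2 2 \<theta> \<omega> \<in> bcoboundaries G 4"
      using b \<theta>' \<omega>'
      by (intro cup_product_bcoboundary[OF G quasicocycle_lift_add_bounded[OF G E, of b C]])
        (auto simp: m_assoc)
    then show ?thesis
      using bclass_bcoboundary[OF G, of "cup_cochain G 2 2 \<theta> \<omega>" 3] by simp
  qed
  \<comment> \<open>With an empty class the union would be empty instead of the zero class.\<close>
  have ne: "?A f \<noteq> {}" for f
  proof -
    have "(\<lambda>gs\<in>tuples G 1. 0) \<in> bcochains G 1"
      by (auto simp: bcochains_def cochains_def)
    then have "bcoboundaries G 2 \<noteq> {}"
      by (auto simp: numeral_2_eq_2)
    then show ?thesis
      using mem_bclass_iff by fastforce
  qed
  have "cup G 2 2 (?A \<phi>) (?A \<psi>) = bcoboundaries G 4"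
    using ne[of \<phi>] ne[of \<psi>] triv by (auto simp: cup_def)
  then show ?thesis
    by (simp add: bounded_cohomology_def FactGroup_def)
qed


section \<open>Weighted counts of subwords\<close>

text \<open>Common frame for two alphabets: signed generators with the sign flipped, and syllables
  (x, m) with the exponent negated.\<close>

locale inverse_letters = group G for G :: "('g, 'm) monoid_scheme" (structure) +
  fixes A :: "'a set" and val :: "'a \<Rightarrow> 'g" and neg :: "'a \<Rightarrow> 'a"
  assumes val_closed: "a \<in> A \<Longrightarrow> val a \<in> carrier G"
    and neg_closed: "a \<in> A \<Longrightarrow> neg a \<in> A"
    and val_neg: "a \<in> A \<Longrightarrow> val (neg a) = inv (val a)"
begin

definition ev :: "'a list \<Rightarrow> 'g" where
  "ev u = foldr (\<lambda>a x. val a \<otimes> x) u \<one>"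

lemma ev_simps [simp]: "ev [] = \<one>" "ev (a # u) = val a \<otimes> ev u"
  by (simp_all add: ev_def)

lemma ev_closed: "set u \<subseteq> A \<Longrightarrow> ev u \<in> carrier G"
  by (induction u) (auto simp: val_closed)

lemma ev_append: "set u \<subseteq> A \<Longrightarrow> set v \<subseteq> A \<Longrightarrow> ev (u @ v) = ev u \<otimes> ev v"
  by (induction u) (auto simp: val_closed ev_closed m_assoc)

lemma ev_inverse: "set u \<subseteq> A \<Longrightarrow> ev (rev (map neg u)) = inv (ev u)"
proof (induction u)
  case (Cons a u)
  moreover have "set (rev (map neg u)) \<subseteq> A"
    using Cons.prems neg_closed by auto
  ultimately show ?case
    by (auto simp: ev_append val_closed ev_closed val_neg neg_closed inv_mult_group)
qed simp

end

text \<open>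
  In a product of two normal forms a middle part \<open>c\<close> cancels against its inverse, up to three
  pieces \<open>r\<^sub>1, r\<^sub>2, r\<^sub>3\<close> of bounded length at the centre of the tripod.
\<close>

locale normal_forms = inverse_letters G A val neg
  for G :: "('g, 'm) monoid_scheme" (structure) and A :: "'a set" and val neg +
  fixes nf :: "'g \<Rightarrow> 'a list" and N :: nat
  assumes nf_closed: "g \<in> carrier G \<Longrightarrow> set (nf g) \<subseteq> A"
    and ev_nf: "g \<in> carrier G \<Longrightarrow> ev (nf g) = g"
    and nf_mult: "g \<in> carrier G \<Longrightarrow> h \<in> carrier G \<Longrightarrow> \<exists>a b c r\<^sub>1 r\<^sub>2 r\<^sub>3.
      nf g = a @ r\<^sub>1 @ c \<and> nf h = rev (map neg c) @ r\<^sub>2 @ b \<and> nf (g \<otimes> h) = a @ r\<^sub>3 @ b \<and>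
      length r\<^sub>1 \<le> N \<and> length r\<^sub>2 \<le> N \<and> length r\<^sub>3 \<le> N"

text \<open>With \<open>L > 0\<close> the empty list has no window. Bound and antisymmetry concern
  all lists, so concrete weights must also be chosen suitably outside the alphabet.\<close>

locale weighted_normal_forms = normal_forms G A val neg nf N
  for G :: "('g, 'm) monoid_scheme" (structure) and A :: "'a set" and val neg nf N +
  fixes wt :: "'a list \<Rightarrow> real" and L :: nat and T :: real
  assumes window_pos: "L > 0"
    and wt_bound: "\<bar>wt v\<bar> \<le> T"
    and wt_inverse: "wt (rev (map neg v)) = - wt v"
begin

lemma T_nonneg: "T \<ge> 0"
  using wt_bound[of "[]"] by linarith

text \<open>\<open>Suc (length u) - L\<close> is the number of windows; truncated subtraction gives
  none when \<open>u\<close> is too short.\<close>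

definition count_wt :: "'a list \<Rightarrow> real" where
  "count_wt u = (\<Sum>k<Suc (length u) - L. wt (take L (drop k u)))"

text \<open>For u = p v s with p of length \<open>k\<close>, the weight of v is split evenly between
  the values of v s and s. Suffixes are used because appending a word of value h multiplies them by
  h on the right, which is the translation in \<open>quasicocycle_lift\<close>.\<close>

definition window_term :: "'a list \<Rightarrow> ('g \<Rightarrow> real) \<Rightarrow> nat \<Rightarrow> real" where
  "window_term u f k = wt (take L (drop k u)) * ((f (ev (drop k u)) + f (ev (drop (k + L) u))) / 2)"

definition window_sum :: "'a list \<Rightarrow> ('g \<Rightarrow> real) \<Rightarrow> real" where
  "window_sum u f = (\<Sum>k<Suc (length u) - L. window_term u f k)"

lemma window_sum_Nil [simp]: "window_sum [] f = 0"
  using window_pos by (simp add: window_sum_def)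

text \<open>Prepending a letter shifts the old windows without changing their suffixes; only a
  window at the front is new.\<close>

lemma window_sum_Cons:
  "window_sum (a # u) f = (if L \<le> Suc (length u) then window_term (a # u) f 0 else 0) + window_sum u f"
proof (cases "L \<le> Suc (length u)")
  case True
  then have "Suc (length (a # u)) - L = Suc (Suc (length u) - L)"
    by simp
  then have "window_sum (a # u) f =
      window_term (a # u) f 0 + (\<Sum>k<Suc (length u) - L. window_term (a # u) f (Suc k))"
    unfolding window_sum_def by (metis sum.lessThan_Suc_shift)
  then show ?thesis
    using True by (simp add: window_sum_def window_term_def)
qed (simp add: window_sum_def)

lemma window_term_bound:
  assumes "set u \<subseteq> A" "\<And>x. x \<in> carrier G \<Longrightarrow> \<bar>f x\<bar> \<le> B"
  shows "\<bar>window_term u f k\<bar> \<le> T * B"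
proof -
  have "ev (drop i u) \<in> carrier G" for i
    using assms(1) by (intro ev_closed) (auto dest: in_set_dropD)
  then have "\<bar>f (ev (drop i u))\<bar> \<le> B" for i
    using assms(2) by blast
  from this[of k] this[of "k + L"]
  have "\<bar>(f (ev (drop k u)) + f (ev (drop (k + L) u))) / 2\<bar> \<le> B"
    by (simp add: abs_le_iff field_simps)
  then show ?thesis
    unfolding window_term_def abs_mult using wt_bound T_nonneg by (intro mult_mono) auto
qed

lemma window_sum_bound:
  assumes "set u \<subseteq> A" "\<And>x. x \<in> carrier G \<Longrightarrow> \<bar>f x\<bar> \<le> B"
  shows "\<bar>window_sum u f\<bar> \<le> length u * (T * B)"
  using assms(1)
proof (induction u)
  case (Cons a u)
  have "\<bar>window_term (a # u) f 0\<bar> \<le> T * B"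
    using Cons.prems assms(2) by (rule window_term_bound)
  with Cons show ?case
    by (auto simp: window_sum_Cons algebra_simps abs_if split: if_splits)
qed simp

text \<open>Windows inside \<open>u\<close> have their suffixes multiplied by \<open>ev v\<close>,
  and windows inside \<open>v\<close> are unchanged. The error comes from windows straddling the
  junction; the minimum in the bound is what the induction on \<open>u\<close> yields.\<close>

lemma window_sum_append:
  assumes "set u \<subseteq> A" "set v \<subseteq> A" and f: "\<And>x. x \<in> carrier G \<Longrightarrow> \<bar>f x\<bar> \<le> B"
  shows "\<bar>window_sum (u @ v) f - window_sum u (\<lambda>x. f (x \<otimes> ev v)) - window_sum v f\<bar>
    \<le> min (length u) L * (T * B)"
  using assms(1)
proof (induction u)
  case (Cons a u)
  have IH: "\<bar>window_sum (u @ v) f - window_sum u (\<lambda>x. f (x \<otimes> ev v)) - window_sum v f\<bar>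
    \<le> min (length u) L * (T * B)"
    using Cons by simp
  show ?case
  proof (cases "L \<le> Suc (length u)")
    case True
    \<comment> \<open>The front window fits into \<open>a # u\<close>, so its term is exactly that
      of the translated function.\<close>
    then have "take L (a # u @ v) = take L (a # u)"
      by (simp add: take_Cons')
    moreover have "drop L (a # w) = drop (L - 1) w" for w
      using window_pos by (simp add: drop_Cons')
    moreover have "drop (L - 1) (u @ v) = drop (L - 1) u @ v"
      using True by simp
    moreover have "set (drop (L - 1) u) \<subseteq> A"
      using Cons.prems by (auto dest: in_set_dropD)
    ultimately have "window_term (a # u @ v) f 0 = window_term (a # u) (\<lambda>x. f (x \<otimes> ev v)) 0"
      using True Cons.prems assms(2)
      by (simp add: window_term_def ev_append val_closed ev_closed m_assoc)
    moreover have "min (length u) L * (T * B) \<le> min (length (a # u)) L * (T * B)"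
      using T_nonneg f[OF one_closed] by (intro mult_right_mono) auto
    ultimately show ?thesis
      using True IH by (simp add: window_sum_Cons)
  next
    case False
    \<comment> \<open>A front window here reaches into \<open>v\<close>. It costs one term, and the
      minimum grows by one because \<open>Suc (length u) < L\<close>.\<close>
    have "\<bar>window_term (a # u @ v) f 0\<bar> \<le> T * B"
      using Cons.prems assms(2) f by (intro window_term_bound) auto
    moreover have "0 \<le> T * B"
      using T_nonneg f[OF one_closed] by auto
    ultimately show ?thesis
      using False IH by (simp add: window_sum_Cons min_def algebra_simps) linarith
  qed
qed simp

text \<open>Inversion mirrors each window and negates its weight. It exchanges the two endpoint
  values, up to translation by the inverse of \<open>ev u\<close>; the even split of the weight
  makes the exchange invisible.\<close>

lemma window_sum_inverse:
  assumes u: "set u \<subseteq> A"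
  shows "window_sum (rev (map neg u)) f = - window_sum u (\<lambda>x. f (x \<otimes> inv (ev u)))"
proof -
  let ?i = "\<lambda>u. rev (map neg u)" and ?n = "Suc (length u) - L"
  have subset: "set (drop j u) \<subseteq> A" "set (take j u) \<subseteq> A" for j
    using u by (auto dest: in_set_dropD in_set_takeD)
  \<comment> \<open>The inverse of a prefix is the complementary suffix times the inverse of the
    whole word.\<close>
  have ev_take: "ev (?i (take j u)) = ev (drop j u) \<otimes> inv (ev u)" for j
  proof -
    have "ev u = ev (take j u) \<otimes> ev (drop j u)"
      using subset by (metis append_take_drop_id ev_append)
    then show ?thesis
      using subset by (simp add: ev_inverse inv_mult_group ev_closed m_assoc[symmetric])
  qed
  have drop_i: "drop j (?i u) = ?i (take (length u - j) u)" for j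
    by (simp add: drop_rev take_map)
  \<comment> \<open>\<open>?n - Suc k\<close> is the mirror position of \<open>k\<close> among the
    \<open>?n\<close> windows.\<close>
  have "window_term (?i u) f (?n - Suc k) = - window_term u (\<lambda>x. f (x \<otimes> inv (ev u))) k"
    if k: "k < ?n" for k
  proof -
    have n: "length u - (?n - Suc k) = k + L" "length u - (?n - Suc k + L) = k"
      using k by auto
    have len: "length (take (k + L) u) = k + L"
      using k by auto
    have "take L (drop (?n - Suc k) (?i u)) = ?i (take L (drop k u))"
      unfolding drop_i n by (simp add: take_rev drop_map drop_take len del: length_take)
    then show ?thesis
      unfolding window_term_def drop_i n ev_take by (simp only: wt_inverse mult_minus_left add.commute)
  qed
  then have "(\<Sum>k<?n. window_term (?i u) f (?n - Suc k)) = - window_sum u (\<lambda>x. f (x \<otimes> inv (ev u)))"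
    by (simp add: window_sum_def sum_negf)
  then show ?thesis
    unfolding sum.nat_diff_reindex by (simp add: window_sum_def)
qed

text \<open>Each of the two junctions costs at most \<open>L\<close> terms, and the middle piece has
  at most \<open>N\<close> windows of its own.\<close>

lemma window_sum_append3:
  assumes "set u \<subseteq> A" "set r \<subseteq> A" "set v \<subseteq> A" "length r \<le> N"
    and f: "\<And>x. x \<in> carrier G \<Longrightarrow> \<bar>f x\<bar> \<le> B"
  shows "\<bar>window_sum (u @ r @ v) f - window_sum u (\<lambda>x. f (x \<otimes> ev (r @ v))) - window_sum v f\<bar>
    \<le> (2 * L + N) * (T * B)"
proof -
  have TB: "0 \<le> T * B"
    using T_nonneg f[OF one_closed] by auto
  have L: "min (length w) L * (T * B) \<le> L * (T * B)" for w :: "'a list"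
    using TB by (intro mult_right_mono) auto
  have "\<bar>window_sum (u @ r @ v) f - window_sum u (\<lambda>x. f (x \<otimes> ev (r @ v))) - window_sum (r @ v) f\<bar>
      \<le> L * (T * B)"
    using window_sum_append[where f = f and B = B, OF assms(1) _ f, of "r @ v"] assms L[of u] by simp
  moreover have "\<bar>window_sum (r @ v) f - window_sum r (\<lambda>x. f (x \<otimes> ev v)) - window_sum v f\<bar>
      \<le> L * (T * B)"
    using window_sum_append[where f = f and B = B, OF assms(2,3) f] L[of r] by simp
  moreover have "\<bar>window_sum r (\<lambda>x. f (x \<otimes> ev v))\<bar> \<le> N * (T * B)"
  proof -
    have "\<bar>window_sum r (\<lambda>x. f (x \<otimes> ev v))\<bar> \<le> length r * (T * B)"
      using assms ev_closed by (intro window_sum_bound) auto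
    also have "\<dots> \<le> N * (T * B)"
      using TB assms(4) by (intro mult_right_mono) auto
    finally show ?thesis .
  qed
  ultimately show ?thesis
    by (simp add: algebra_simps abs_if split: if_splits)
qed

lemma window_sum_cong:
  assumes "set u \<subseteq> A" "\<And>x. x \<in> carrier G \<Longrightarrow> f x = f' x"
  shows "window_sum u f = window_sum u f'"
proof -
  have "ev (drop i u) \<in> carrier G" for i
    using assms(1) by (intro ev_closed) (auto dest: in_set_dropD)
  then show ?thesis
    by (simp add: window_sum_def window_term_def assms(2))
qed

text \<open>Each leg of the tripod lies in two of the three normal forms, and its two contributions
  cancel exactly: \<open>a\<close> and \<open>b\<close> because their translates agree,
  \<open>c\<close> by inversion. Only the errors of three splittings remain.\<close>

lemma window_sum_defect:
  assumes g: "g \<in> carrier G" and h: "h \<in> carrier G" and f: "\<And>x. x \<in> carrier G \<Longrightarrow> \<bar>f x\<bar> \<le> B"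
  shows "\<bar>window_sum (nf h) f + window_sum (nf g) (\<lambda>x. f (x \<otimes> h)) - window_sum (nf (g \<otimes> h)) f\<bar>
    \<le> 3 * ((2 * L + N) * (T * B))"
proof -
  obtain a b c r\<^sub>1 r\<^sub>2 r\<^sub>3 where
    nf: "nf g = a @ r\<^sub>1 @ c" "nf h = rev (map neg c) @ r\<^sub>2 @ b" "nf (g \<otimes> h) = a @ r\<^sub>3 @ b"
    and len: "length r\<^sub>1 \<le> N" "length r\<^sub>2 \<le> N" "length r\<^sub>3 \<le> N"
    using nf_mult[OF g h] by blast
  have sub: "set a \<subseteq> A" "set b \<subseteq> A" "set c \<subseteq> A" "set r\<^sub>1 \<subseteq> A" "set r\<^sub>2 \<subseteq> A" "set r\<^sub>3 \<subseteq> A"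
    "set (rev (map neg c)) \<subseteq> A"
    using nf_closed[OF g] nf_closed[OF h] nf_closed[OF m_closed[OF g h]] unfolding nf by auto
  note closed = sub[THEN ev_closed]
  have ev_g: "g = ev a \<otimes> (ev r\<^sub>1 \<otimes> ev c)" and ev_h: "h = inv (ev c) \<otimes> (ev r\<^sub>2 \<otimes> ev b)"
    and ev_gh: "g \<otimes> h = ev a \<otimes> (ev r\<^sub>3 \<otimes> ev b)"
    using ev_nf[OF g] ev_nf[OF h] ev_nf[OF m_closed[OF g h]] sub
    unfolding nf by (simp_all add: ev_append ev_inverse)
  \<comment> \<open>Cancelling \<open>ev a\<close> on the left shows that \<open>a\<close> is
    followed by the same element in g h and in the right translate of g by h.\<close>
  have r: "ev (r\<^sub>1 @ c) \<otimes> h = ev (r\<^sub>3 @ b)"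
    using ev_gh unfolding ev_g using sub closed h by (simp add: ev_append m_assoc)
  have "\<bar>window_sum (nf g) (\<lambda>x. f (x \<otimes> h))
      - window_sum a (\<lambda>x. f (x \<otimes> ev (r\<^sub>1 @ c) \<otimes> h)) - window_sum c (\<lambda>x. f (x \<otimes> h))\<bar>
      \<le> (2 * L + N) * (T * B)"
    unfolding nf using sub len f h by (intro window_sum_append3) auto
  moreover have "window_sum a (\<lambda>x. f (x \<otimes> ev (r\<^sub>1 @ c) \<otimes> h)) = window_sum a (\<lambda>x. f (x \<otimes> ev (r\<^sub>3 @ b)))"
    using sub closed h by (intro window_sum_cong) (auto simp: m_assoc ev_append r[symmetric])
  moreover have "\<bar>window_sum (nf (g \<otimes> h)) f - window_sum a (\<lambda>x. f (x \<otimes> ev (r\<^sub>3 @ b))) - window_sum b f\<bar>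
      \<le> (2 * L + N) * (T * B)"
    unfolding nf using sub len f by (intro window_sum_append3) auto
  moreover have "\<bar>window_sum (nf h) f - window_sum (rev (map neg c)) (\<lambda>x. f (x \<otimes> ev (r\<^sub>2 @ b)))
      - window_sum b f\<bar> \<le> (2 * L + N) * (T * B)"
    unfolding nf using sub len f by (intro window_sum_append3) auto
  \<comment> \<open>By the factorisation of \<open>h\<close>, the inverse of \<open>ev c\<close>
    times the value of the rest of \<open>nf h\<close> is \<open>h\<close>, the translate with which
    \<open>c\<close> occurs in g.\<close>
  moreover have "window_sum (rev (map neg c)) (\<lambda>x. f (x \<otimes> ev (r\<^sub>2 @ b))) = - window_sum c (\<lambda>x. f (x \<otimes> h))"
    unfolding window_sum_inverse[OF sub(3)] ev_h using sub closed
    by (intro arg_cong[where f = uminus] window_sum_cong) (auto simp: m_assoc ev_append)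
  ultimately show ?thesis
    by linarith
qed

text \<open>On the constant function 1 the two halves recombine to the full weight, so the total
  mass is the weighted count.\<close>

lemma quasicocycle_lift_count_wt:
  assumes "\<And>g. g \<in> carrier G \<Longrightarrow> \<phi> g = count_wt (nf g)"
  shows "quasicocycle_lift G \<phi> (\<lambda>g. window_sum (nf g))"
proof -
  have "window_sum u (\<lambda>x. f x + f' x) = window_sum u f + window_sum u f'" for u f f'
    by (simp add: window_sum_def window_term_def sum.distrib[symmetric] algebra_simps add_divide_distrib)
  moreover have "window_sum u (\<lambda>x. c * f x) = c * window_sum u f" for u c f
    by (simp add: window_sum_def window_term_def sum_distrib_left algebra_simps add_divide_distrib)
  moreover have "window_sum (nf g) (\<lambda>_. 1) = \<phi> g" if "g \<in> carrier G" for g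
    by (simp add: assms[OF that] window_sum_def window_term_def count_wt_def)
  moreover have "window_sum (nf g) f = window_sum (nf g) f'"
    if "g \<in> carrier G" "\<forall>x\<in>carrier G. f x = f' x" for g f f'
    using that nf_closed by (intro window_sum_cong) auto
  moreover have "\<bar>window_sum (nf h) f + window_sum (nf g) (\<lambda>x. f (x \<otimes> h)) - window_sum (nf (g \<otimes> h)) f\<bar>
      \<le> 3 * ((2 * L + N) * T) * B"
    if "g \<in> carrier G" "h \<in> carrier G" "\<forall>x\<in>carrier G. \<bar>f x\<bar> \<le> B" for g h f B
    using window_sum_defect[of g h f B] that by (simp add: mult.assoc)
  moreover from this have "\<exists>K. \<forall>B f. (\<forall>x\<in>carrier G. \<bar>f x\<bar> \<le> B) \<longrightarrow>
      (\<forall>g\<in>carrier G. \<forall>h\<in>carrier G.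
        \<bar>window_sum (nf h) f + window_sum (nf g) (\<lambda>x. f (x \<otimes> h)) - window_sum (nf (g \<otimes> h)) f\<bar>
        \<le> K * B)"
    by (intro exI[of _ "3 * ((2 * L + N) * T)"]) blast
  ultimately show ?thesis
    unfolding quasicocycle_lift_def by (intro conjI ballI allI impI) auto
qed

end


section \<open>Brooks quasimorphisms\<close>

lemma reduced_words_append:
  "u @ v \<in> reduced_words S \<longleftrightarrow> u \<in> reduced_words S \<and> v \<in> reduced_words S \<and>
     (u = [] \<or> v = [] \<or> \<not> (fst (last u) = fst (hd v) \<and> snd (last u) \<noteq> snd (hd v)))"
  by (auto simp: reduced_words_def successively_append_iff case_prod_unfold)

lemma inv_word_append: "inv_word (u @ v) = inv_word v @ inv_word u"
  by (simp add: inv_word_def)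

lemma inv_word_inv_word [simp]: "inv_word (inv_word w) = w"
  by (simp add: inv_word_def rev_map case_prod_unfold comp_def)

text \<open>Letters at the end of \<open>u\<close> cancel against the start of \<open>v\<close>
  until two facing letters are not inverse or a word is exhausted. Reducedness concerns neighbours
  only, so what remains is reduced.\<close>

lemma reduced_words_cancel:
  assumes "u \<in> reduced_words S" "v \<in> reduced_words S"
  obtains a b c where "u = a @ c" "v = inv_word c @ b" "a @ b \<in> reduced_words S"
  using assms
proof (induction u arbitrary: v thesis rule: rev_induct)
  case Nil
  then show ?case
    by (auto simp: inv_word_def)
next
  case (snoc l u)
  obtain x e where l: "l = (x, e)"
    by fastforce
  have u: "u \<in> reduced_words S"
    using snoc.prems by (simp add: reduced_words_append)
  show ?case
  proof (cases "\<exists>v'. v = (x, \<not> e) # v'")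
    case True
    then obtain v' where v': "v = (x, \<not> e) # v'"
      by blast
    then have "v' \<in> reduced_words S"
      using snoc.prems(3) reduced_words_append[of "[(x, \<not> e)]" v' S] by simp
    then obtain a b c where "u = a @ c" "v' = inv_word c @ b" "a @ b \<in> reduced_words S"
      using snoc.IH u by blast
    then show ?thesis
      using snoc.prems(1)[of a "c @ [l]" b] v' by (simp add: l inv_word_append) (simp add: inv_word_def)
  next
    case False
    then have "(u @ [l]) @ v \<in> reduced_words S"
      unfolding reduced_words_append[of "u @ [l]" v] using snoc.prems(2,3) by (cases v) (auto simp: l)
    then show ?thesis
      using snoc.prems(1)[of "u @ [l]" "[]" v] by (simp add: inv_word_def)
  qed
qed

text \<open>An occurrence is determined by the length of its prefix; the sum runs over the windows
  of \<open>count_wt\<close>.\<close>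

lemma real_occurrences:
  "real (occurrences w v) =
     (\<Sum>k<Suc (length v) - length w. if take (length w) (drop k v) = w then 1 else 0)"
proof -
  let ?K = "{k. k < Suc (length v) - length w \<and> take (length w) (drop k v) = w}"
  have "bij_betw (\<lambda>(p, s). length p) {(p, s). v = p @ w @ s} ?K"
  proof (rule bij_betw_byWitness[where f' = "\<lambda>k. (take k v, drop (k + length w) v)"])
    have "v = take k v @ w @ drop (k + length w) v" if "take (length w) (drop k v) = w" for k
      using that by (metis append_take_drop_id drop_drop add.commute)
    then show "(\<lambda>k. (take k v, drop (k + length w) v)) ` ?K \<subseteq> {(p, s). v = p @ w @ s}"
      by auto
  qed auto
  then have "occurrences w v = card ?K"
    unfolding occurrences_def by (rule bij_betw_same_card)
  also have "real \<dots> = (\<Sum>k\<in>?K. 1)"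
    by simp
  also have "\<dots> = (\<Sum>k<Suc (length v) - length w. if take (length w) (drop k v) = w then 1 else 0)"
    by (rule sum.mono_neutral_cong_left) auto
  finally show ?thesis .
qed

section \<open>Reduced words as normal forms\<close>

context free_group
begin

lemma word_letters:
  "inverse_letters G (S \<times> UNIV) (\<lambda>(x, b). if b then x else inv x) (\<lambda>(x, b). (x, \<not> b))"
  using generators_closed by unfold_locales auto

interpretation words: inverse_letters G "S \<times> UNIV" "\<lambda>(x, b). if b then x else inv x" "\<lambda>(x, b). (x, \<not> b)"
  by (rule word_letters)

lemma words_ev: "words.ev = eval_word G"
  unfolding fun_eq_iff words.ev_def eval_word_def by (simp add: case_prod_unfold)

lemma reduced_word_eqI:
  assumes "w \<in> reduced_words S" "eval_word G w = g"
  shows "reduced_word G S g = w"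
  using assms unique_reduced_word unfolding reduced_word_def bij_betw_def inj_on_def
  by (intro the_equality) auto

lemma reduced_word:
  assumes "g \<in> carrier G"
  shows "reduced_word G S g \<in> reduced_words S" "eval_word G (reduced_word G S g) = g"
proof -
  have "g \<in> eval_word G ` reduced_words S"
    using assms unique_reduced_word by (simp add: bij_betw_def)
  then obtain w where "w \<in> reduced_words S" "eval_word G w = g"
    by blast
  then show "reduced_word G S g \<in> reduced_words S" "eval_word G (reduced_word G S g) = g"
    using reduced_word_eqI by auto
qed

text \<open>Letters cancel exactly, so the central pieces are empty and \<open>N = 0\<close>.
  Uniqueness identifies the reduced list \<open>a @ b\<close> as the normal form of the
  product.\<close>

lemma reduced_word_normal_forms:
  "normal_forms G (S \<times> UNIV) (\<lambda>(x, b). if b then x else inv x) (\<lambda>(x, b). (x, \<not> b)) (reduced_word G S) 0"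
proof
  have letters: "set w \<subseteq> S \<times> UNIV" if "w \<in> reduced_words S" for w
    using that by (simp add: reduced_words_def)
  show "set (reduced_word G S g) \<subseteq> S \<times> UNIV" if "g \<in> carrier G" for g
    using letters reduced_word(1)[OF that] .
  show "words.ev (reduced_word G S g) = g" if "g \<in> carrier G" for g
    using reduced_word(2)[OF that] by (simp add: words_ev)
  show "\<exists>a b c r\<^sub>1 r\<^sub>2 r\<^sub>3. reduced_word G S g = a @ r\<^sub>1 @ c \<and>
      reduced_word G S h = rev (map (\<lambda>(x, b). (x, \<not> b)) c) @ r\<^sub>2 @ b \<and>
      reduced_word G S (g \<otimes> h) = a @ r\<^sub>3 @ b \<and> length r\<^sub>1 \<le> 0 \<and> length r\<^sub>2 \<le> 0 \<and> length r\<^sub>3 \<le> 0"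
    if g: "g \<in> carrier G" and h: "h \<in> carrier G" for g h
  proof -
    obtain a b c where abc: "reduced_word G S g = a @ c" "reduced_word G S h = inv_word c @ b"
      "a @ b \<in> reduced_words S"
      using reduced_word(1)[OF g] reduced_word(1)[OF h] by (rule reduced_words_cancel)
    have sub: "set a \<subseteq> S \<times> UNIV" "set b \<subseteq> S \<times> UNIV" "set c \<subseteq> S \<times> UNIV"
      "set (inv_word c) \<subseteq> S \<times> UNIV"
      using letters[OF reduced_word(1)[OF g]] letters[OF reduced_word(1)[OF h]] by (auto simp: abc)
    note closed = sub[THEN words.ev_closed]
    have "words.ev (inv_word c) = inv (words.ev c)"
      unfolding inv_word_def using sub by (intro words.ev_inverse)
    then have "words.ev a \<otimes> words.ev b = (words.ev a \<otimes> words.ev c) \<otimes> (words.ev (inv_word c) \<otimes> words.ev b)"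
      using closed by (simp add: m_assoc inv_solve_left' flip: m_assoc[of "words.ev c"])
    also have "\<dots> = g \<otimes> h"
      using reduced_word(2)[OF g] reduced_word(2)[OF h] sub
      by (simp add: abc words.ev_append flip: words_ev)
    finally have "reduced_word G S (g \<otimes> h) = a @ b"
      using abc(3) sub by (intro reduced_word_eqI) (auto simp: words.ev_append simp flip: words_ev)
    with abc(1,2) show ?thesis
      unfolding inv_word_def by (intro exI[of _ a] exI[of _ b] exI[of _ c] exI[of _ "[]"]) simp
  qed
qed

lemma quasicocycle_lift_brooks:
  assumes "is_brooks G S \<phi>"
  shows "\<exists>E. quasicocycle_lift G \<phi> E"
proof -
  obtain w where \<phi>: "\<And>g. g \<in> carrier G \<Longrightarrow> \<phi> g = brooks G S w g"
    using assms by (auto simp: is_brooks_def)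
  show ?thesis
  proof (cases "w = []")
    case True
    \<comment> \<open>Windows must have positive length. For empty \<open>w\<close> the two counts
      agree, so \<phi> vanishes and the zero functional lifts it.\<close>
    then have "quasicocycle_lift G \<phi> (\<lambda>g f. 0)"
      using \<phi> by (auto simp: quasicocycle_lift_def brooks_def inv_word_def intro: exI[of _ 0])
    then show ?thesis
      by blast
  next
    case False
    define wt :: "'g word \<Rightarrow> real" where
      "wt v = (if v = w then 1 else 0) - (if v = inv_word w then 1 else 0)" for v
    have swap: "inv_word v = w \<longleftrightarrow> v = inv_word w" "inv_word v = inv_word w \<longleftrightarrow> v = w" for v
      by (metis inv_word_inv_word)+
    interpret counts: weighted_normal_forms G "S \<times> UNIV" "\<lambda>(x, b). if b then x else inv x"
      "\<lambda>(x, b). (x, \<not> b)" "reduced_word G S" 0 wt "length w" 1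
    proof (intro weighted_normal_forms.intro weighted_normal_forms_axioms.intro reduced_word_normal_forms)
      show "wt (rev (map (\<lambda>(x, b). (x, \<not> b)) v)) = - wt v" for v
        by (simp add: wt_def swap flip: inv_word_def)
    qed (use False in \<open>auto simp: wt_def\<close>)
    \<comment> \<open>Equal lengths let both counts run over the same windows.\<close>
    have "length (inv_word w) = length w"
      by (simp add: inv_word_def)
    then have "counts.count_wt u = real (occurrences w u) - real (occurrences (inv_word w) u)" for u
      by (simp add: counts.count_wt_def wt_def real_occurrences sum_subtractf)
    then show ?thesis
      using counts.quasicocycle_lift_count_wt[of \<phi>] \<phi> by (auto simp: brooks_def)
  qed
qed

end


section \<open>Rolli quasimorphisms\<close>

lemma syllable_forms_append:
  "u @ v \<in> syllable_forms S \<longleftrightarrow> u \<in> syllable_forms S \<and> v \<in> syllable_forms S \<and>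
     (u = [] \<or> v = [] \<or> fst (last u) \<noteq> fst (hd v))"
  by (auto simp: syllable_forms_def successively_append_iff case_prod_unfold)

lemma syllable_forms_Cons:
  "(x, m) # v \<in> syllable_forms S \<longleftrightarrow> x \<in> S \<and> m \<noteq> 0 \<and> v \<in> syllable_forms S \<and>
     (v = [] \<or> x \<noteq> fst (hd v))"
  by (cases v) (auto simp: syllable_forms_def)

text \<open>The induction is as for words, but two facing powers of one generator may merge without
  cancelling. The second alternative records this single merge, where cancellation stops.\<close>

lemma syllable_forms_cancel:
  assumes "u \<in> syllable_forms S" "v \<in> syllable_forms S"
  obtains a b c where "u = a @ c" "v = rev (map (\<lambda>(x, m). (x, - m)) c) @ b" "a @ b \<in> syllable_forms S"
  | a b c x m n where "u = a @ [(x, m)] @ c" "v = rev (map (\<lambda>(x, m). (x, - m)) c) @ [(x, n)] @ b"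
      "a @ [(x, m + n)] @ b \<in> syllable_forms S"
  using assms
proof (induction u arbitrary: v thesis rule: rev_induct)
  case Nil
  then show ?case
    by auto
next
  case (snoc l u)
  obtain x m where l: "l = (x, m)"
    by fastforce
  have u: "u \<in> syllable_forms S" "x \<in> S" "u = [] \<or> fst (last u) \<noteq> x"
    using snoc.prems by (auto simp: syllable_forms_append syllable_forms_Cons l)
  show ?case
  proof (cases "\<exists>n v'. v = (x, n) # v'")
    case True
    then obtain n v' where v': "v = (x, n) # v'"
      by blast
    then have v'_form: "v' \<in> syllable_forms S" "v' = [] \<or> x \<noteq> fst (hd v')"
      using snoc.prems(4) by (auto simp: syllable_forms_Cons)
    show ?thesis
    proof (cases "m + n = 0")
      case True
      then have n: "n = - m"
        by simp
      show ?thesis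
      proof (rule snoc.IH[OF _ _ u(1) v'_form(1)])
        fix a b c
        assume "u = a @ c" "v' = rev (map (\<lambda>(x, m). (x, - m)) c) @ b" "a @ b \<in> syllable_forms S"
        then show ?thesis
          using snoc.prems(1)[of a "c @ [l]" b] by (simp add: l v' n)
      next
        fix a b c y k k'
        assume "u = a @ [(y, k)] @ c" "v' = rev (map (\<lambda>(x, m). (x, - m)) c) @ [(y, k')] @ b"
          "a @ [(y, k + k')] @ b \<in> syllable_forms S"
        then show ?thesis
          using snoc.prems(2)[of a y k "c @ [l]" k' b] by (simp add: l v' n)
      qed
    next
      case False
      then have "u @ [(x, m + n)] @ v' \<in> syllable_forms S"
        using u v'_form by (simp add: syllable_forms_append[of u] syllable_forms_Cons)
      then show ?thesis
        using snoc.prems(2)[of u x m "[]" n v'] by (simp add: l v')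
    qed
  next
    case False
    then have "(u @ [l]) @ v \<in> syllable_forms S"
      unfolding syllable_forms_append[of "u @ [l]" v] using snoc.prems(3,4) by (cases v) (auto simp: l)
    then show ?thesis
      using snoc.prems(1)[of "u @ [l]" "[]" v] by simp
  qed
qed

section \<open>Passage between reduced words and syllable forms\<close>

fun push_syllable :: "'g \<times> int \<Rightarrow> ('g \<times> int) list \<Rightarrow> ('g \<times> int) list" where
  "push_syllable (x, m) [] = [(x, m)]"
| "push_syllable (x, m) ((y, n) # ys) =
     (if x = y then if m + n = 0 then ys else (x, m + n) # ys else (x, m) # (y, n) # ys)"

definition syllables_of_word :: "'g word \<Rightarrow> ('g \<times> int) list" where
  "syllables_of_word w = foldr (\<lambda>(x, b). push_syllable (x, if b then 1 else - 1)) w []"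

definition word_of_syllables :: "('g \<times> int) list \<Rightarrow> 'g word" where
  "word_of_syllables ys = concat (map (\<lambda>(x, m). replicate (nat \<bar>m\<bar>) (x, m > 0)) ys)"

lemma word_of_syllables_simps [simp]:
  "word_of_syllables [] = []"
  "word_of_syllables ((x, m) # ys) = replicate (nat \<bar>m\<bar>) (x, m > 0) @ word_of_syllables ys"
  by (simp_all add: word_of_syllables_def)

lemma push_syllable_form:
  "x \<in> S \<Longrightarrow> m \<noteq> 0 \<Longrightarrow> ys \<in> syllable_forms S \<Longrightarrow> push_syllable (x, m) ys \<in> syllable_forms S"
  by (cases "((x, m), ys)" rule: push_syllable.cases) (auto simp: syllable_forms_Cons)

lemma syllables_of_word_form:
  "set w \<subseteq> S \<times> UNIV \<Longrightarrow> syllables_of_word w \<in> syllable_forms S"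
proof (induction w)
  case Nil
  then show ?case
    by (simp add: syllables_of_word_def syllable_forms_def)
next
  case (Cons a w)
  then show ?case
    by (cases a) (auto simp: syllables_of_word_def intro!: push_syllable_form)
qed

lemma push_syllable_fresh: "ys = [] \<or> fst (hd ys) \<noteq> x \<Longrightarrow> push_syllable (x, m) ys = (x, m) # ys"
  by (cases "((x, m), ys)" rule: push_syllable.cases) auto

text \<open>The letter next to \<open>w\<close> opens a new syllable, and each further letter moves
  the exponent away from 0. The run has length \<open>Suc k\<close> because an empty run gives no
  syllable.\<close>

lemma syllables_of_word_replicate:
  assumes "syllables_of_word w = [] \<or> fst (hd (syllables_of_word w)) \<noteq> x"
  shows "syllables_of_word (replicate (Suc k) (x, b) @ w) =
    (x, if b then int (Suc k) else - int (Suc k)) # syllables_of_word w"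
proof (induction k)
  case 0
  then show ?case
    using assms by (simp add: syllables_of_word_def push_syllable_fresh)
next
  case (Suc k)
  have "syllables_of_word (replicate (Suc (Suc k)) (x, b) @ w) =
      push_syllable (x, if b then 1 else - 1) (syllables_of_word (replicate (Suc k) (x, b) @ w))"
    by (simp add: syllables_of_word_def)
  then show ?case
    unfolding Suc by simp
qed

text \<open>This makes \<open>word_of_syllables\<close> injective on syllable forms, so uniqueness
  passes from reduced words to syllable forms.\<close>

lemma syllables_of_word_of_syllables:
  "ys \<in> syllable_forms S \<Longrightarrow> syllables_of_word (word_of_syllables ys) = ys"
proof (induction ys)
  case Nil
  then show ?case
    by (simp add: syllables_of_word_def)
next
  case (Cons y ys)
  obtain x m where y: "y = (x, m)"
    by fastforce
  have ys: "ys \<in> syllable_forms S" "ys = [] \<or> fst (hd ys) \<noteq> x" "m \<noteq> 0"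
    using Cons.prems by (auto simp: y syllable_forms_Cons)
  then obtain k where "nat \<bar>m\<bar> = Suc k"
    by (metis abs_eq_0 nat_0_iff not0_implies_Suc abs_ge_zero order_antisym)
  then show ?case
    using Cons.IH[OF ys(1)] ys(2) syllables_of_word_replicate[of "word_of_syllables ys" x k "m > 0"]
    by (auto simp: y simp del: replicate_Suc)
qed

text \<open>Letters within a run are equal and neighbouring runs have different generators, so no
  letter meets its inverse.\<close>

lemma word_of_syllables_reduced:
  "ys \<in> syllable_forms S \<Longrightarrow> word_of_syllables ys \<in> reduced_words S"
proof (induction ys)
  case Nil
  then show ?case
    by (simp add: reduced_words_def)
next
  case (Cons y ys)
  obtain x m where y: "y = (x, m)"
    by fastforce
  have ys: "ys \<in> syllable_forms S" "ys = [] \<or> fst (hd ys) \<noteq> x" "x \<in> S"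
    using Cons.prems by (auto simp: y syllable_forms_Cons)
  have "replicate k (x, b) \<in> reduced_words S" for k b
    using ys(3) by (induction k) (auto simp: reduced_words_def successively_Cons)
  moreover have "ys = [] \<or> fst (hd (word_of_syllables ys)) \<noteq> x"
    using ys by (cases ys) (auto simp: syllable_forms_Cons hd_append)
  ultimately show ?case
    using Cons.IH[OF ys(1)] by (auto simp: y reduced_words_append)
qed

section \<open>Syllable decompositions as normal forms\<close>

context free_group
begin

interpretation words: inverse_letters G "S \<times> UNIV" "\<lambda>(x, b). if b then x else inv x" "\<lambda>(x, b). (x, \<not> b)"
  by (rule word_letters)

lemma syllable_letters:
  "inverse_letters G (S \<times> (UNIV - {0})) (\<lambda>(x, m :: int). x [^] m) (\<lambda>(x, m). (x, - m))"
  using generators_closed by unfold_locales (auto simp: int_pow_neg subset_iff)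

interpretation syll: inverse_letters G "S \<times> (UNIV - {0})" "\<lambda>(x, m :: int). x [^] m" "\<lambda>(x, m). (x, - m)"
  by (rule syllable_letters)

lemma syll_ev: "syll.ev = eval_syllables G"
  unfolding fun_eq_iff syll.ev_def eval_syllables_def by (simp add: case_prod_unfold)

lemma eval_push_syllable:
  assumes "x \<in> S" "ys \<in> syllable_forms S"
  shows "syll.ev (push_syllable (x, m) ys) = x [^] m \<otimes> syll.ev ys"
proof (cases ys)
  case (Cons y zs)
  obtain z n where y: "y = (z, n)"
    by fastforce
  have "set zs \<subseteq> S \<times> (UNIV - {0})" "z \<in> S"
    using assms(2) by (auto simp: Cons y syllable_forms_def)
  then have "syll.ev zs \<in> carrier G" "x \<in> carrier G" "z \<in> carrier G"
    using generators_closed assms(1) syll.ev_closed by auto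
  moreover have "x [^] m \<otimes> (x [^] n \<otimes> g) = x [^] (m + n) \<otimes> g" if "g \<in> carrier G" for g
    using that \<open>x \<in> carrier G\<close> by (simp add: int_pow_mult m_assoc)
  ultimately show ?thesis
    by (auto simp: Cons y)
qed simp

lemma eval_syllables_of_word:
  "set w \<subseteq> S \<times> UNIV \<Longrightarrow> syll.ev (syllables_of_word w) = words.ev w"
proof (induction w)
  case Nil
  then show ?case
    by (simp add: syllables_of_word_def)
next
  case (Cons a w)
  obtain x b where a: "a = (x, b)"
    by fastforce
  have "x \<in> S" "syllables_of_word w \<in> syllable_forms S"
    using Cons.prems by (auto simp: a intro!: syllables_of_word_form)
  moreover have "syllables_of_word (a # w) = push_syllable (x, if b then 1 else - 1) (syllables_of_word w)"
    by (simp add: a syllables_of_word_def)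
  ultimately show ?case
    using Cons generators_closed by (auto simp: a eval_push_syllable int_pow_neg subset_iff)
qed

lemma eval_word_of_syllables:
  "ys \<in> syllable_forms S \<Longrightarrow> words.ev (word_of_syllables ys) = syll.ev ys"
  using eval_syllables_of_word[of "word_of_syllables ys"] word_of_syllables_reduced[of ys S]
  by (simp add: syllables_of_word_of_syllables reduced_words_def)

text \<open>Two syllable forms of \<open>g\<close> spell reduced words with the same value. These
  agree by freeness, hence so do the forms.\<close>

lemma syllables_eqI:
  assumes "ys \<in> syllable_forms S" "syll.ev ys = g"
  shows "syllables G S g = ys"
  unfolding syllables_def
proof (rule the_equality)
  show "ys \<in> syllable_forms S \<and> eval_syllables G ys = g"
    using assms by (simp add: syll_ev)
next
  fix zs
  assume zs: "zs \<in> syllable_forms S \<and> eval_syllables G zs = g"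
  then have "eval_word G (word_of_syllables zs) = eval_word G (word_of_syllables ys)"
    using assms eval_word_of_syllables[of zs] eval_word_of_syllables[of ys]
    by (simp add: syll_ev words_ev)
  moreover have "word_of_syllables zs \<in> reduced_words S" "word_of_syllables ys \<in> reduced_words S"
    using zs assms(1) word_of_syllables_reduced by blast+
  ultimately have "word_of_syllables zs = word_of_syllables ys"
    using unique_reduced_word unfolding bij_betw_def inj_on_def by blast
  then show "zs = ys"
    using zs assms(1) syllables_of_word_of_syllables by metis
qed

text \<open>Existence comes from collapsing the reduced word of \<open>g\<close> into
  syllables.\<close>

lemma syllables:
  assumes "g \<in> carrier G"
  shows "syllables G S g \<in> syllable_forms S" "syll.ev (syllables G S g) = g"
proof -
  have "set (reduced_word G S g) \<subseteq> S \<times> UNIV"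
    using reduced_word(1)[OF assms] by (simp add: reduced_words_def)
  then have "syllables_of_word (reduced_word G S g) \<in> syllable_forms S"
    "syll.ev (syllables_of_word (reduced_word G S g)) = g"
    using reduced_word(2)[OF assms] by (simp_all add: syllables_of_word_form eval_syllables_of_word words_ev)
  then show "syllables G S g \<in> syllable_forms S" "syll.ev (syllables G S g) = g"
    using syllables_eqI by auto
qed

text \<open>One merge of facing syllables can occur at the centre, whence
  \<open>N = 1\<close>.\<close>

lemma syllables_normal_forms:
  "normal_forms G (S \<times> (UNIV - {0})) (\<lambda>(x, m :: int). x [^] m) (\<lambda>(x, m). (x, - m)) (syllables G S) 1"
proof
  have letters: "set ys \<subseteq> S \<times> (UNIV - {0})" if "ys \<in> syllable_forms S" for ys
    using that by (simp add: syllable_forms_def)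
  show "set (syllables G S g) \<subseteq> S \<times> (UNIV - {0})" if "g \<in> carrier G" for g
    using letters syllables(1)[OF that] .
  show "syll.ev (syllables G S g) = g" if "g \<in> carrier G" for g
    using syllables(2)[OF that] .
  let ?i = "\<lambda>c. rev (map (\<lambda>(x, m). (x, - m)) c)"
  \<comment> \<open>Covers both alternatives of the cancellation: what matters is that
    \<open>r\<^sub>3\<close> has the value of \<open>r\<^sub>1\<close> times that of
    \<open>r\<^sub>2\<close>.\<close>
  have cancel: "\<exists>a b c r\<^sub>1 r\<^sub>2 r\<^sub>3. syllables G S g = a @ r\<^sub>1 @ c \<and> syllables G S h = ?i c @ r\<^sub>2 @ b \<and>
      syllables G S (g \<otimes> h) = a @ r\<^sub>3 @ b \<and> length r\<^sub>1 \<le> 1 \<and> length r\<^sub>2 \<le> 1 \<and> length r\<^sub>3 \<le> 1"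
    if g: "g \<in> carrier G" and h: "h \<in> carrier G"
      and ug: "syllables G S g = a @ r\<^sub>1 @ c" and uh: "syllables G S h = ?i c @ r\<^sub>2 @ b"
      and form: "a @ r\<^sub>3 @ b \<in> syllable_forms S" and r: "syll.ev r\<^sub>3 = syll.ev r\<^sub>1 \<otimes> syll.ev r\<^sub>2"
      and len: "length r\<^sub>1 \<le> 1" "length r\<^sub>2 \<le> 1" "length r\<^sub>3 \<le> 1"
    for g h a b c r\<^sub>1 r\<^sub>2 r\<^sub>3
  proof -
    have sub: "set a \<subseteq> S \<times> (UNIV - {0})" "set b \<subseteq> S \<times> (UNIV - {0})" "set c \<subseteq> S \<times> (UNIV - {0})"
      "set r\<^sub>1 \<subseteq> S \<times> (UNIV - {0})" "set r\<^sub>2 \<subseteq> S \<times> (UNIV - {0})" "set r\<^sub>3 \<subseteq> S \<times> (UNIV - {0})"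
      "set (?i c) \<subseteq> S \<times> (UNIV - {0})"
      using letters[OF syllables(1)[OF g]] letters[OF syllables(1)[OF h]] letters[OF form]
      unfolding ug uh by auto
    note closed = sub[THEN syll.ev_closed]
    have "syll.ev (a @ r\<^sub>3 @ b) = syll.ev a \<otimes> (syll.ev r\<^sub>1 \<otimes> (syll.ev r\<^sub>2 \<otimes> syll.ev b))"
      using sub closed by (simp add: syll.ev_append r m_assoc)
    also have "\<dots> = (syll.ev a \<otimes> (syll.ev r\<^sub>1 \<otimes> syll.ev c)) \<otimes> (syll.ev (?i c) \<otimes> (syll.ev r\<^sub>2 \<otimes> syll.ev b))"
      unfolding syll.ev_inverse[OF sub(3)] using closed
      by (simp add: m_assoc flip: m_assoc[of "syll.ev c"])
    also have "\<dots> = g \<otimes> h"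
      using syllables(2)[OF g] syllables(2)[OF h] sub unfolding ug uh by (simp add: syll.ev_append)
    finally have "syllables G S (g \<otimes> h) = a @ r\<^sub>3 @ b"
      using form by (intro syllables_eqI)
    with ug uh len show ?thesis
      by blast
  qed
  show "\<exists>a b c r\<^sub>1 r\<^sub>2 r\<^sub>3. syllables G S g = a @ r\<^sub>1 @ c \<and> syllables G S h = ?i c @ r\<^sub>2 @ b \<and>
      syllables G S (g \<otimes> h) = a @ r\<^sub>3 @ b \<and> length r\<^sub>1 \<le> 1 \<and> length r\<^sub>2 \<le> 1 \<and> length r\<^sub>3 \<le> 1"
    if g: "g \<in> carrier G" and h: "h \<in> carrier G" for g h
    using syllables(1)[OF g] syllables(1)[OF h]
  proof (cases rule: syllable_forms_cancel)
    case (1 a b c)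
    then show ?thesis
      by (intro cancel[OF g h, of a "[]" c "[]" b "[]"]) auto
  next
    case (2 a b c x m n)
    have "x \<in> carrier G"
      using 2(3) generators_closed by (auto simp: syllable_forms_def)
    with 2 show ?thesis
      by (intro cancel[OF g h, of a "[(x, m)]" c "[(x, n)]" b "[(x, m + n)]"]) (auto simp: int_pow_mult)
  qed
qed

text \<open>Windows of length 1 are single syllables, so the Rolli sum is a weighted count.\<close>

lemma quasicocycle_lift_rolli:
  assumes "is_rolli G S \<phi>"
  shows "\<exists>E. quasicocycle_lift G \<phi> E"
proof -
  obtain lam where fin: "finite S" and bounded: "\<forall>x\<in>S. \<exists>B. \<forall>m. \<bar>lam x m\<bar> \<le> B"
    and odd: "\<And>x m. x \<in> S \<Longrightarrow> lam x (- m) = - lam x m"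
    and \<phi>: "\<And>g. g \<in> carrier G \<Longrightarrow> \<phi> g = rolli G S lam g"
    using assms unfolding is_rolli_def by blast
  obtain B where B: "\<And>x m. x \<in> S \<Longrightarrow> \<bar>lam x m\<bar> \<le> B x"
    using bchoice[OF bounded] by blast
  \<comment> \<open>The value 0 off singletons over \<open>S\<close> extends antisymmetry and the
    bound to all lists.\<close>
  define wt :: "('g \<times> int) list \<Rightarrow> real" where
    "wt v = (case v of [(x, m)] \<Rightarrow> if x \<in> S then lam x m else 0 | _ \<Rightarrow> 0)" for v
  \<comment> \<open>Finiteness of \<open>S\<close> turns the bounds for single generators into a
    uniform one.\<close>
  have lam_bound: "\<bar>lam x m\<bar> \<le> (\<Sum>x\<in>S. \<bar>B x\<bar>)" if "x \<in> S" for x m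
    using B[OF that, of m] member_le_sum[OF that, of "\<lambda>x. \<bar>B x\<bar>"] fin by force
  interpret counts: weighted_normal_forms G "S \<times> (UNIV - {0})" "\<lambda>(x, m :: int). x [^] m"
    "\<lambda>(x, m). (x, - m)" "syllables G S" 1 wt 1 "\<Sum>x\<in>S. \<bar>B x\<bar>"
  proof (intro weighted_normal_forms.intro weighted_normal_forms_axioms.intro syllables_normal_forms)
    show "\<bar>wt v\<bar> \<le> (\<Sum>x\<in>S. \<bar>B x\<bar>)" for v
      by (auto simp: wt_def lam_bound sum_nonneg split: list.split)
    show "wt (rev (map (\<lambda>(x, m). (x, - m)) v)) = - wt v" for v
    proof (cases "length v = 1")
      case True
      then show ?thesis
        by (auto simp: length_Suc_conv wt_def odd)
    next
      case False
      have "wt u = 0" if "length u \<noteq> 1" for u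
        using that by (auto simp: wt_def split: list.split)
      then show ?thesis
        using False by simp
    qed
  qed simp
  have "counts.count_wt u = (\<Sum>(x, m)\<leftarrow>u. lam x m)" if "set u \<subseteq> S \<times> (UNIV - {0})" for u
  proof -
    have "wt (take 1 (drop k u)) = (case u ! k of (x, m) \<Rightarrow> lam x m)" if "k < length u" for k
    proof -
      have "take 1 (drop k u) = [u ! k]"
        using that by (simp add: take_Suc_conv_app_nth)
      moreover have "u ! k \<in> S \<times> (UNIV - {0})"
        using that \<open>set u \<subseteq> _\<close> nth_mem by blast
      ultimately show ?thesis
        by (auto simp: wt_def)
    qed
    then show ?thesis
      unfolding counts.count_wt_def by (simp add: sum_list_sum_nth atLeast0LessThan)
  qed
  then have "\<phi> g = counts.count_wt (syllables G S g)" if "g \<in> carrier G" for g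
    using \<phi>[OF that] syllables(1)[OF that] by (simp add: rolli_def syllable_forms_def)
  then show ?thesis
    using counts.quasicocycle_lift_count_wt[of \<phi>] by blast
qed

end

theorem theorem1:
  fixes G :: "('g, 'm) monoid_scheme" and S :: "'g set" and \<phi> \<psi> :: "'g \<Rightarrow> real"
  assumes "free_group G S"
    and "\<not> comm_group G"
    and "quasimorphism G \<phi>"
    and "quasimorphism G \<psi>"
    and "is_brooks G S \<phi> \<or> is_rolli G S \<phi>"
    and "is_brooks G S \<psi> \<or> is_rolli G S \<psi>"
  shows "cup G 2 2
           (bclass G 2 (coboundary G 1 (one_cochain G \<phi>)))
           (bclass G 2 (coboundary G 1 (one_cochain G \<psi>)))
         = \<one>\<^bsub>bounded_cohomology G 4\<^esub>"
proof -
  interpret free_group G S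
    by fact
  \<comment> \<open>Either kind of \<phi> is a weighted count and so has a lift; \<psi> enters
    through the boundedness of its coboundary.\<close>
  obtain E where "quasicocycle_lift G \<phi> E"
    using assms(5) quasicocycle_lift_brooks quasicocycle_lift_rolli by blast
  then show ?thesis
    using group_axioms assms(4) by (intro cup_eq_one)
qed

end
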